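(* Let $n\ge 8$ and let $K_n$ be the complete graph on the vertex set $[n]=\{1,\dots,n\}$. For $H\in\mathcal F(K_n)$ set $$\Phi_n(H)=\{N_H(c): c\in V(H)\text{ is a created vertex}\}.$$ Then $\Phi_n$ is a well-defined canonical $S_n$-equivariant isomorphism of graded directed graphs $$\Phi_n:\mathcal G(K_n)\xrightarrow{\ \sim\ }\mathcal P(n).$$ That is: for each $H\in\mathcal F(K_n)$, $\Phi_n(H)$ is a partial Steiner system on $[n]$; $\Phi_n$ is a bijection from $V(\mathcal G(K_n))=\mathcal F(K_n)$ onto $V(\mathcal P(n))$; there is a forward edge from $H$ to $K$ in $\mathcal G(K_n)$ if and only if there is a forward edge from $\Phi_n(H)$ to $\Phi_n(K)$ in $\mathcal P(n)$; $\Phi_n$ preserves the gradings, i.e. $|V(H)|-n=|\Phi_n(H)|$; and $\Phi_n(\sigma H)=\sigma\Phi_n(H)$ for all $\sigma\in S_n$.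
   Context: A graph is a finite simple undirected graph; $N_H(x)$ is the neighbourhood of $x$ in $H$. A triangle is a 3-cycle. Moves. A $\Delta$-Y move on a graph $H$ at a triangle $T\subset H$ removes the three edges of $T$ and adds a new vertex adjacent to exactly the three vertices of $T$. A Y-$\Delta$ move on $H$ at a vertex $x$ of degree $3$ removes $x$ and adds those edges among the three neighbours of $x$ that are missing, so that the neighbours form a triangle (the graph stays simple). Each move induces a partial graph embedding from the old graph to the new one: its domain is the old graph minus the edges of $T$ (for $\Delta$-Y), respectively the old graph minus $x$ (for Y-$\Delta$). Vertices of the new graph are identified with their preimages under this embedding. Family. $\mathcal F(G)$ is the family of graphs obtainable from $G$ by a finite (possibly empty) sequence of $\Delta$-Y and Y-$\Delta$ moves. Created and original vertices. For $H\in\mathcal F(G)$, a vertex $y\in V(H)$ is original if there is a sequence of $\Delta$-Y or Y-$\Delta$ moves $G=H_0,\dots,H_m=H$ whose composite partial embedding sends some $x\in V(G)$ (in its domain) to $y$; otherwise $y$ is created. Labelling convention. Moves keep the names of surviving vertices, and the vertex added by a $\Delta$-Y move is given a fresh name (not in $V(G)$ and not used in any earlier graph of the sequence). So the original vertices of $H$ carry their labels from $V(G)$. Two members of $\mathcal F(G)$ that differ only by renaming created vertices are regarded as the same. $\mathcal G(K_n)$ is the directed graph with vertex set $\mathcal F(K_n)$ and a forward edge from $H$ to $K$ if and only if $K$ is obtainable from $H$ by a single $\Delta$-Y move. It is graded by vertex number, normalised as $H\mapsto|V(H)|-n$. A partial Steiner system on $n$ points is a set $\mathcal A\subset\binom{[n]}{3}$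 of triples (blocks) such that no pair of points of $[n]$ belongs to two distinct blocks of $\mathcal A$. $\mathcal P(n)$ is the directed graph whose vertices are all partial Steiner systems on $n$ points, with a forward edge from $\mathcal A$ to $\mathcal A'$ if and only if $\mathcal A\subset\mathcal A'$ and $|\mathcal A'\setminus\mathcal A|=1$; it is graded by $\mathcal A\mapsto|\mathcal A|$. $S_n$ acts on $\mathcal F(K_n)$ by relabelling original vertices ($\sigma H$ is $H$ with each original vertex $i\in[n]$ renamed $\sigma(i)$) and on $\mathcal P(n)$ by applying $\sigma$ to every block. "Canonical" means that, once $V(K_n)$ is identified with $[n]$, no further choice of labelling is involved. *)

theory Defs
  imports
    "Graph_Theory.Pair_Digraph"
    "Graph_Theory.Kuratowski"
    "HOL-Combinatorics.Permutations"
begin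

text \<open>
  A finite simple undirected graph is a \<^locale>\<open>pair_graph\<close>: the edge between
  \<open>u\<close> and \<open>v\<close> is represented by the two arcs \<open>(u, v)\<close> and \<open>(v, u)\<close>. Vertex names are natural
  numbers, so that there is always a fresh one.
\<close>

type_synonym lgraph = "nat pair_pre_digraph"

definition nbhd :: "lgraph \<Rightarrow> nat \<Rightarrow> nat set" where
  "nbhd H x = {v. (x, v) \<in> parcs H}"

definition triangle :: "lgraph \<Rightarrow> nat set \<Rightarrow> bool" where
  "triangle H T \<longleftrightarrow> T \<subseteq> pverts H \<and> card T = 3 \<and> (\<forall>u\<in>T. \<forall>v\<in>T. u \<noteq> v \<longrightarrow> (u, v) \<in> parcs H)"

definition complete_graph :: "nat \<Rightarrow> lgraph" where
  "complete_graph n = \<lparr> pverts = {1..n}, parcs = {(u, v). u \<in> {1..n} \<and> v \<in> {1..n} \<and> u \<noteq> v} \<rparr>"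

lemma complete_graph_is_complete: "complete_digraph n (with_proj (complete_graph n))"
  unfolding complete_digraph_pair_def by (auto simp: complete_graph_def)


subsection \<open>Moves and their partial embeddings\<close>

definition delta_Y :: "lgraph \<Rightarrow> nat set \<Rightarrow> nat \<Rightarrow> lgraph" where
  "delta_Y H T z =
     \<lparr> pverts = insert z (pverts H),
       parcs = (parcs H - T \<times> T) \<union> {z} \<times> T \<union> T \<times> {z} \<rparr>"

definition Y_delta :: "lgraph \<Rightarrow> nat \<Rightarrow> lgraph" where
  "Y_delta H x =
     \<lparr> pverts = pverts H - {x},
       parcs = {(u, v) \<in> parcs H. u \<noteq> x \<and> v \<noteq> x}
                 \<union> {(u, v). u \<in> nbhd H x \<and> v \<in> nbhd H x \<and> u \<noteq> v} \<rparr>"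

text \<open>
  The vertex maps of the induced partial embeddings. Since surviving vertices keep their names,
  each is the identity on its domain.
\<close>

definition delta_Y_emb :: "lgraph \<Rightarrow> nat \<rightharpoonup> nat" where
  "delta_Y_emb H = Some |` pverts H"

definition Y_delta_emb :: "lgraph \<Rightarrow> nat \<Rightarrow> nat \<rightharpoonup> nat" where
  "Y_delta_emb H x = Some |` (pverts H - {x})"

text \<open>
  \<open>move_seq G Hs f\<close>: \<open>Hs\<close> lists the successive graphs of a sequence of moves starting at \<open>G\<close>,
  and \<open>f\<close> is its composite partial embedding. A new vertex has a name that occurs in no
  earlier graph of the sequence, in particular not in \<open>G\<close>.
\<close>

inductive move_seq :: "lgraph \<Rightarrow> lgraph list \<Rightarrow> (nat \<rightharpoonup> nat) \<Rightarrow> bool" for G where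
  start: "move_seq G [G] (Some |` pverts G)"
| delta_Y_step:
    "move_seq G Hs f \<Longrightarrow> triangle (last Hs) T \<Longrightarrow> z \<notin> \<Union> (pverts ` set Hs)
     \<Longrightarrow> move_seq G (Hs @ [delta_Y (last Hs) T z]) (delta_Y_emb (last Hs) \<circ>\<^sub>m f)"
| Y_delta_step:
    "move_seq G Hs f \<Longrightarrow> x \<in> pverts (last Hs) \<Longrightarrow> card (nbhd (last Hs) x) = 3
     \<Longrightarrow> move_seq G (Hs @ [Y_delta (last Hs) x]) (Y_delta_emb (last Hs) x \<circ>\<^sub>m f)"

definition labelled_family :: "lgraph \<Rightarrow> lgraph set" where
  "labelled_family G = {H. \<exists>Hs f. move_seq G Hs f \<and> last Hs = H}"

definition original :: "lgraph \<Rightarrow> lgraph \<Rightarrow> nat set" where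
  "original G H =
     {y \<in> pverts H. \<exists>Hs f. move_seq G Hs f \<and> last Hs = H \<and> (\<exists>x\<in>pverts G. f x = Some y)}"

definition created :: "lgraph \<Rightarrow> lgraph \<Rightarrow> nat set" where
  "created G H = pverts H - original G H"


subsection \<open>The family, up to renaming created vertices\<close>

definition rename :: "(nat \<Rightarrow> nat) \<Rightarrow> lgraph \<Rightarrow> lgraph" where
  "rename g H = \<lparr> pverts = g ` pverts H, parcs = map_prod g g ` parcs H \<rparr>"

definition created_renaming :: "lgraph \<Rightarrow> lgraph rel" where
  "created_renaming G =
     {(H, K). H \<in> labelled_family G \<and> K \<in> labelled_family G \<and>
        (\<exists>g. inj_on g (pverts H) \<and> (\<forall>x\<in>original G H. g x = x) \<and>
             g ` created G H = created G K \<and> K = rename g H)}"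

definition family :: "lgraph \<Rightarrow> lgraph set set" where
  "family G = labelled_family G // created_renaming G"

definition family_digraph :: "lgraph \<Rightarrow> lgraph set pair_pre_digraph" where
  "family_digraph G =
     \<lparr> pverts = family G,
       parcs = {(C, D). C \<in> family G \<and> D \<in> family G \<and>
         (\<exists>H\<in>C. \<exists>T z. triangle H T \<and> z \<notin> pverts G \<union> pverts H \<and> delta_Y H T z \<in> D)} \<rparr>"

text \<open>
  Renaming the original vertices. The map is applied to labelled graphs; a class is
  acted on elementwise.
\<close>

definition relabel :: "lgraph \<Rightarrow> (nat \<Rightarrow> nat) \<Rightarrow> lgraph \<Rightarrow> lgraph" where
  "relabel G \<sigma> H = rename (\<lambda>v. if v \<in> original G H then \<sigma> v else v) H"

definition family_act :: "lgraph \<Rightarrow> (nat \<Rightarrow> nat) \<Rightarrow> lgraph set \<Rightarrow> lgraph set" where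
  "family_act G \<sigma> C = relabel G \<sigma> ` C"


subsection \<open>Partial Steiner systems\<close>

definition partial_steiner :: "nat \<Rightarrow> nat set set \<Rightarrow> bool" where
  "partial_steiner n A \<longleftrightarrow>
     (\<forall>B\<in>A. B \<subseteq> {1..n} \<and> card B = 3) \<and>
     (\<forall>p\<in>{1..n}. \<forall>q\<in>{1..n}. p \<noteq> q \<longrightarrow>
        \<not> (\<exists>B\<in>A. \<exists>B'\<in>A. B \<noteq> B' \<and> {p, q} \<subseteq> B \<and> {p, q} \<subseteq> B'))"

definition steiner_digraph :: "nat \<Rightarrow> nat set set pair_pre_digraph" where
  "steiner_digraph n =
     \<lparr> pverts = {A. partial_steiner n A},
       parcs = {(A, A'). partial_steiner n A \<and> partial_steiner n A' \<and>
                         A \<subset> A' \<and> card (A' - A) = 1} \<rparr>"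

definition steiner_act :: "(nat \<Rightarrow> nat) \<Rightarrow> nat set set \<Rightarrow> nat set set" where
  "steiner_act \<sigma> A = (\<lambda>B. \<sigma> ` B) ` A"


subsection \<open>The map on labelled graphs and on classes\<close>

definition Phi_labelled :: "nat \<Rightarrow> lgraph \<Rightarrow> nat set set" where
  "Phi_labelled n H = {nbhd H c | c. c \<in> created (complete_graph n) H}"

text \<open>
  The common value of \<^const>\<open>Phi_labelled\<close> on the members of a class; this is meaningful only
  once \<^const>\<open>Phi_labelled\<close> is known to respect \<^const>\<open>created_renaming\<close>.
\<close>

definition Phi :: "nat \<Rightarrow> lgraph set \<Rightarrow> nat set set" where
  "Phi n C = the_elem (Phi_labelled n ` C)"


subsection \<open>Basic facts\<close>

lemma pair_graph_iff:
  "pair_graph (H :: 'a pair_pre_digraph) \<longleftrightarrow>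
     finite (pverts H) \<and> parcs H \<subseteq> pverts H \<times> pverts H \<and>
     (\<forall>u v. (u, v) \<in> parcs H \<longrightarrow> (v, u) \<in> parcs H \<and> u \<noteq> v)" (is "?L = ?R")
proof
  assume ?L
  then interpret pair_graph H .
  show ?R
  proof (intro conjI allI impI)
    show "finite (pverts H)" by (rule pair_finite_verts)
    show "parcs H \<subseteq> pverts H \<times> pverts H" by (auto dest: wellformed')
    fix u v assume uv: "(u, v) \<in> parcs H"
    show "(v, u) \<in> parcs H"
      using uv pair_sym_arcs by (auto simp: symmetric_def dest: symD)
    show "u \<noteq> v" using pair_no_loops[OF uv] by simp
  qed
next
  assume R: ?R
  then have "finite (parcs H)"
    by (meson finite_SigmaI finite_subset)
  with R show ?L
    by unfold_locales (auto simp: symmetric_def sym_def)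
qed

lemma pair_graph_complete_graph: "pair_graph (complete_graph n)"
  unfolding pair_graph_iff by (auto simp: complete_graph_def)

lemma pair_graph_delta_Y:
  assumes "pair_graph H" "triangle H T" "z \<notin> pverts H"
  shows "pair_graph (delta_Y H T z)"
  using assms unfolding pair_graph_iff triangle_def delta_Y_def by auto

lemma pair_graph_Y_delta:
  assumes "pair_graph H"
  shows "pair_graph (Y_delta H x)"
  using assms unfolding pair_graph_iff Y_delta_def nbhd_def by auto

lemma move_seq_last_in_set: "move_seq G Hs f \<Longrightarrow> last Hs \<in> set Hs"
  by (induction rule: move_seq.induct) auto

lemma pair_graph_labelled_family:
  assumes "pair_graph G" "H \<in> labelled_family G"
  shows "pair_graph H"
proof -
  have "pair_graph (last Hs)" if "move_seq G Hs f" for Hs f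
    using that
  proof (induction rule: move_seq.induct)
    case start
    then show ?case using assms by simp
  next
    case (delta_Y_step Hs f T z)
    then show ?case
      using move_seq_last_in_set[OF delta_Y_step.hyps(1)] by (auto intro!: pair_graph_delta_Y)
  next
    case (Y_delta_step Hs f x)
    then show ?case by (auto intro!: pair_graph_Y_delta)
  qed
  then show ?thesis using assms by (auto simp: labelled_family_def)
qed

lemma rename_comp: "rename h (rename g H) = rename (h \<circ> g) H"
  by (simp add: rename_def image_comp map_prod.comp)

lemma rename_cong_id:
  assumes "pair_graph H" "\<And>x. x \<in> pverts H \<Longrightarrow> g x = x"
  shows "rename g H = H"
proof -
  have "map_prod g g e = e" if "e \<in> parcs H" for e
    using that assms unfolding pair_graph_iff by (cases e) auto
  then show ?thesis
    using assms by (simp add: rename_def cong: image_cong)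
qed

lemma equiv_created_renaming:
  assumes G: "pair_graph G"
  shows "equiv (labelled_family G) (created_renaming G)"
proof (rule equivI)
  show "created_renaming G \<subseteq> labelled_family G \<times> labelled_family G"
    by (auto simp: created_renaming_def)
next
  show "refl_on (labelled_family G) (created_renaming G)"
  proof (rule refl_onI)
    fix H assume H: "H \<in> labelled_family G"
    then have "rename (\<lambda>x. x) H = H"
      using rename_cong_id[OF pair_graph_labelled_family[OF G H]] by simp
    then show "(H, H) \<in> created_renaming G"
      using H unfolding created_renaming_def by (auto intro!: exI[of _ "\<lambda>x. x"])
  qed
next
  show "sym (created_renaming G)"
  proof (rule symI)
    fix H K assume "(H, K) \<in> created_renaming G"
    then obtain g where H: "H \<in> labelled_family G" and K: "K \<in> labelled_family G"
      and g: "inj_on g (pverts H)" "\<And>x. x \<in> original G H \<Longrightarrow> g x = x"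
        "g ` created G H = created G K" and KH: "K = rename g H"
      by (auto simp: created_renaming_def)
    define h where "h = inv_into (pverts H) g"
    have hg: "h (g x) = x" if "x \<in> pverts H" for x
      using that g(1) by (simp add: h_def)
    have V: "pverts K = g ` pverts H" by (simp add: KH rename_def)
    have oH: "original G H \<subseteq> pverts H" and oK: "original G K \<subseteq> pverts K"
      by (auto simp: original_def)
    have oK': "x \<in> original G H" if "x \<in> original G K" for x
    proof -
      have "x \<in> g ` pverts H" using subsetD[OF oK that] by (simp only: V)
      then obtain y where y: "y \<in> pverts H" "x = g y" by (elim imageE)
      have "x \<notin> created G K" using that by (simp add: created_def)
      then have "y \<notin> created G H" using g(3) y by blast
      then have "y \<in> original G H" using y by (auto simp: created_def)
      then show ?thesis using g(2) y by simp
    qed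
    have "h x = x" if "x \<in> original G K" for x
      using oK'[OF that] oH g(2) hg by (metis subsetD)
    moreover have "inj_on h (pverts K)"
      by (auto simp: V inj_on_def hg)
    moreover have "h ` created G K = created G H"
    proof -
      have "h ` g ` created G H = (\<lambda>x. x) ` created G H"
        unfolding image_image by (rule image_cong) (auto simp: hg created_def)
      then show ?thesis using g(3) by simp
    qed
    moreover have "H = rename h K"
      using rename_cong_id[OF pair_graph_labelled_family[OF G H], of "h \<circ> g"] hg
      by (simp add: KH rename_comp)
    ultimately show "(K, H) \<in> created_renaming G"
      using H K unfolding created_renaming_def by auto
  qed
next
  show "trans (created_renaming G)"
  proof (rule transI)
    fix H K L assume "(H, K) \<in> created_renaming G" "(K, L) \<in> created_renaming G"
    then obtain g h where HKL: "H \<in> labelled_family G" "L \<in> labelled_family G"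
      and g: "inj_on g (pverts H)" "\<And>x. x \<in> original G H \<Longrightarrow> g x = x"
        "g ` created G H = created G K" and KH: "K = rename g H"
      and h: "inj_on h (pverts K)" "\<And>x. x \<in> original G K \<Longrightarrow> h x = x"
        "h ` created G K = created G L" and LK: "L = rename h K"
      by (auto simp: created_renaming_def)
    have V: "pverts K = g ` pverts H" by (simp add: KH rename_def)
    have "x \<in> original G K" if "x \<in> original G H" for x
    proof -
      have xH: "x \<in> pverts H" using that by (auto simp: original_def)
      then have "x \<in> pverts K" using g(2)[OF that] imageI[of x _ g] by (simp add: V)
      moreover have "x \<notin> created G K"
      proof
        assume "x \<in> created G K"
        then obtain y where "y \<in> created G H" "x = g y" using g(3) by auto
        then have "y = x"
          using g(1) g(2)[OF that] xH by (metis DiffD1 created_def inj_onD)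
        then show False using \<open>y \<in> created G H\<close> that by (auto simp: created_def)
      qed
      ultimately show ?thesis by (auto simp: created_def)
    qed
    then have "\<forall>x\<in>original G H. (h \<circ> g) x = x" using g(2) h(2) by auto
    moreover have "inj_on (h \<circ> g) (pverts H)" using g(1) h(1) V by (simp add: comp_inj_on)
    moreover have "(h \<circ> g) ` created G H = created G L" by (simp only: image_comp[symmetric] g(3) h(3))
    moreover have "L = rename (h \<circ> g) H" by (simp add: LK KH rename_comp)
    ultimately show "(H, L) \<in> created_renaming G"
      using HKL unfolding created_renaming_def by blast
  qed
qed

end

theory Submission
  imports Defs
begin

text \<open>
  Every labelled graph reached from the complete graph on \<open>{1..n}\<close> encodes a partial Steiner
  system: it is the graph \<open>S(A, c)\<close> obtained by a \<open>\<Delta>\<close>-Y move at each block of a partial Steiner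
  system \<open>A\<close>, the vertex added at the block \<open>B\<close> being named \<open>c B\<close>. The neighbourhood of
  \<open>c B\<close> is \<open>B\<close>, so \<open>A\<close> can be read off from the graph.

  This form is preserved by moves. A triangle of \<open>S(A, c)\<close> avoids every \<open>c B\<close>, because the
  neighbours of \<open>c B\<close> are pairwise nonadjacent; so the triangles are exactly the triples that
  extend \<open>A\<close> to a larger partial Steiner system (\<open>triangle_steiner_graph\<close>), and a
  \<open>\<Delta>\<close>-Y move adds such a block. For \<open>n \<ge> 8\<close> every point of \<open>{1..n}\<close> keeps degree at
  least 4 (\<open>degree_point\<close>), so a Y-\<open>\<Delta>\<close> move happens at some \<open>c B\<close> and deletes the block
  \<open>B\<close>. In particular the points are never removed: they are the original vertices, and the
  \<open>c B\<close> are the created ones. Conversely every \<open>S(A, c)\<close> is reached by adding the blocks of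
  \<open>A\<close> one at a time (\<open>steiner_graph_reachable\<close>).

  Hence two labelled graphs differ by a renaming of created vertices if and only if they have the
  same \<open>A\<close> (\<open>created_renaming_iff_Phi_labelled\<close>), so that the classes of the family correspond
  to the partial Steiner systems. Edges, vertex numbers and the action of permutations are then
  computed on the graphs \<open>S(A, c)\<close>.
\<close>


section \<open>Partial Steiner systems\<close>

lemma partial_steinerD:
  assumes "partial_steiner n A" "B \<in> A"
  shows "B \<subseteq> {1..n}" "card B = 3" "finite B"
proof -
  show "B \<subseteq> {1..n}" "card B = 3" using assms by (auto simp: partial_steiner_def)
  then show "finite B" by (metis card.infinite zero_neq_numeral)
qed

lemma partial_steiner_unique:
  assumes "partial_steiner n A" "B \<in> A" "B' \<in> A" "p \<in> B" "q \<in> B" "p \<in> B'" "q \<in> B'" "p \<noteq> q"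
  shows "B = B'"
proof -
  have "p \<in> {1..n}" "q \<in> {1..n}" using partial_steinerD(1)[OF assms(1,2)] assms(4,5) by blast+
  then show ?thesis using assms unfolding partial_steiner_def by blast
qed

lemma partial_steiner_finite: "partial_steiner n A \<Longrightarrow> finite A"
  by (rule finite_subset[of _ "Pow {1..n}"]) (auto simp: partial_steiner_def)

lemma partial_steiner_subset: "partial_steiner n A \<Longrightarrow> A' \<subseteq> A \<Longrightarrow> partial_steiner n A'"
  unfolding partial_steiner_def by (meson subsetD)

lemma partial_steiner_insert:
  assumes "partial_steiner n A" "T \<subseteq> {1..n}" "card T = 3"
    and "\<And>u v B. u \<in> T \<Longrightarrow> v \<in> T \<Longrightarrow> u \<noteq> v \<Longrightarrow> B \<in> A \<Longrightarrow> u \<in> B \<Longrightarrow> v \<in> B \<Longrightarrow> False"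
  shows "partial_steiner n (insert T A)"
proof -
  have "B = B'" if B: "B \<in> insert T A" "B' \<in> insert T A" 
      and pq: "p \<noteq> q" "{p, q} \<subseteq> B" "{p, q} \<subseteq> B'" for p q B B'
  proof -
    have mem: "p \<in> B" "q \<in> B" "p \<in> B'" "q \<in> B'" using pq by auto
    consider "B = B'" | "B \<in> A" "B' \<in> A" | "B = T" "B' \<in> A" | "B \<in> A" "B' = T"
      using B by blast
    then show ?thesis
      using partial_steiner_unique[OF assms(1) _ _ mem pq(1)] assms(4)[of p q] mem pq(1)
      by cases auto
  qed
  moreover have "B \<subseteq> {1..n} \<and> card B = 3" if "B \<in> insert T A" for B
    using that assms(2,3) partial_steinerD[OF assms(1)] by blast
  ultimately show ?thesis unfolding partial_steiner_def by meson
qed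

lemma partial_steiner_image:
  assumes "\<sigma> permutes {1..n}" "partial_steiner n A"
  shows "partial_steiner n (steiner_act \<sigma> A)"
proof -
  have inj: "inj \<sigma>" using permutes_inj[OF assms(1)] .
  have "\<sigma> ` B \<subseteq> {1..n} \<and> card (\<sigma> ` B) = 3" if "B \<in> A" for B
  proof
    show "\<sigma> ` B \<subseteq> {1..n}"
      using partial_steinerD(1)[OF assms(2) that] permutes_image[OF assms(1)] by blast
    show "card (\<sigma> ` B) = 3"
      using partial_steinerD(2)[OF assms(2) that] card_image[OF inj_on_subset[OF inj subset_UNIV]]
      by metis
  qed
  moreover have "\<sigma> ` B = \<sigma> ` B'"
    if BB: "B \<in> A" "B' \<in> A" and ne: "p \<noteq> q"
      and pB: "{p, q} \<subseteq> \<sigma> ` B" and pB': "{p, q} \<subseteq> \<sigma> ` B'" for p q B B'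
  proof -
    obtain p' q' where "p' \<in> B" "q' \<in> B" and pq: "p = \<sigma> p'" "q = \<sigma> q'"
      using pB by auto
    moreover have "p' \<in> B'" "q' \<in> B'" "p' \<noteq> q'"
      using ne pB' inj unfolding pq by (auto dest: injD)
    ultimately show ?thesis using partial_steiner_unique[OF assms(2) BB] by metis
  qed
  ultimately show ?thesis
    unfolding partial_steiner_def steiner_act_def ball_simps bex_simps by meson
qed


section \<open>The graph of a partial Steiner system\<close>

text \<open>
  The graph obtained from the complete graph on \<open>{1..n}\<close> by a \<open>\<Delta>\<close>-Y move at every block of
  \<open>A\<close>; \<open>c B\<close> is the name of the vertex added at the block \<open>B\<close>.
\<close>

definition steiner_graph :: "nat \<Rightarrow> nat set set \<Rightarrow> (nat set \<Rightarrow> nat) \<Rightarrow> lgraph" where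
  "steiner_graph n A c =
     \<lparr> pverts = {1..n} \<union> c ` A,
       parcs = {(u, v). u \<in> {1..n} \<and> v \<in> {1..n} \<and> u \<noteq> v \<and> \<not> (\<exists>B\<in>A. u \<in> B \<and> v \<in> B)}
                 \<union> {(u, v). \<exists>B\<in>A. u = c B \<and> v \<in> B} \<union> {(u, v). \<exists>B\<in>A. v = c B \<and> u \<in> B} \<rparr>"

text \<open>
  The blocks of the partial Steiner system \<open>A\<close> have been given distinct names by \<open>c\<close>,
  none of which is a point. The values of \<open>c\<close> outside \<open>A\<close> are irrelevant.
\<close>

definition named_steiner :: "nat \<Rightarrow> nat set set \<Rightarrow> (nat set \<Rightarrow> nat) \<Rightarrow> bool" where
  "named_steiner n A c \<longleftrightarrow> partial_steiner n A \<and> inj_on c A \<and> (\<forall>B\<in>A. c B \<notin> {1..n})"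

lemma pverts_steiner_graph: "pverts (steiner_graph n A c) = {1..n} \<union> c ` A"
  by (simp add: steiner_graph_def)

lemma steiner_graph_empty: "steiner_graph n {} c = complete_graph n"
  by (simp add: steiner_graph_def complete_graph_def)

lemma named_steiner_notin:
  assumes "named_steiner n A c" "B \<in> A"
  shows "c B \<notin> {1..n}" "B' \<in> A \<Longrightarrow> c B \<notin> B'"
proof -
  show "c B \<notin> {1..n}" using assms by (simp add: named_steiner_def)
  then show "c B \<notin> B'" if "B' \<in> A"
    using assms(1) partial_steinerD(1)[OF _ that] unfolding named_steiner_def by blast
qed

lemma nbhd_centre:
  assumes "named_steiner n A c" "B \<in> A"
  shows "nbhd (steiner_graph n A c) (c B) = B"
proof -
  have "inj_on c A" using assms(1) by (simp add: named_steiner_def)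
  then show ?thesis
    using assms(2) named_steiner_notin[OF assms]
    by (auto simp: nbhd_def steiner_graph_def simp del: atLeastAtMost_iff dest: inj_onD)
qed

text \<open>
  A point \<open>x\<close> loses two neighbours and gains one for each block through it. This is where
  \<open>n \<ge> 8\<close> enters: its degree stays at least \<open>(n - 1) / 2 > 3\<close>.
\<close>

lemma degree_point:
  assumes A: "named_steiner n A c" and x: "x \<in> {1..n}"
  shows "n - 1 \<le> 2 * card (nbhd (steiner_graph n A c) x)"
proof -
  let ?H = "steiner_graph n A c"
  \<comment> \<open>\<open>?g w\<close> contains the points other than \<open>x\<close> that are reached through the neighbour \<open>w\<close>:
    \<open>w\<close> itself if it is a point, and otherwise the other two points of the block centred at \<open>w\<close>.\<close>
  let ?g = "\<lambda>w. if w \<in> {1..n} then {w} else nbhd ?H w - {x}"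
  have P: "partial_steiner n A" using A by (simp add: named_steiner_def)
  have "nbhd ?H x \<subseteq> {1..n} \<union> c ` A"
    using partial_steinerD(1)[OF P] unfolding nbhd_def steiner_graph_def by auto
  then have fin: "finite (nbhd ?H x)"
    by (rule finite_subset) (simp add: partial_steiner_finite[OF P])
  have "{1..n} - {x} \<subseteq> (\<Union>w\<in>nbhd ?H x. ?g w)"
  proof
    fix v assume v: "v \<in> {1..n} - {x}"
    show "v \<in> (\<Union>w\<in>nbhd ?H x. ?g w)"
    proof (cases "\<exists>B\<in>A. x \<in> B \<and> v \<in> B")
      case True
      then obtain B where B: "B \<in> A" "x \<in> B" "v \<in> B" by blast
      then have "c B \<in> nbhd ?H x" by (auto simp: nbhd_def steiner_graph_def)
      moreover have "v \<in> ?g (c B)"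
        using A B v nbhd_centre[OF A B(1)] by (auto simp: named_steiner_def)
      ultimately show ?thesis by blast
    next
      case False
      then have "v \<in> nbhd ?H x" using x v by (auto simp: nbhd_def steiner_graph_def)
      moreover have "v \<in> ?g v" using v by simp
      ultimately show ?thesis by blast
    qed
  qed
  moreover have g: "finite (?g w) \<and> card (?g w) \<le> 2" if w: "w \<in> nbhd ?H x" for w
  proof (cases "w \<in> {1..n}")
    case False
    then obtain B where B: "B \<in> A" "w = c B" "x \<in> B"
      using w named_steiner_notin(1)[OF A] x
      by (auto simp: nbhd_def steiner_graph_def simp del: atLeastAtMost_iff)
    then have "?g w = B - {x}" using False nbhd_centre[OF A B(1)] by auto
    then show ?thesis using B partial_steinerD[OF P B(1)] by simp
  qed simp
  ultimately have "card ({1..n} - {x}) \<le> card (\<Union>w\<in>nbhd ?H x. ?g w)"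
    using fin by (intro card_mono) blast+
  also have "\<dots> \<le> (\<Sum>w\<in>nbhd ?H x. card (?g w))" by (rule card_UN_le[OF fin])
  also have "\<dots> \<le> card (nbhd ?H x) * 2"
    using sum_bounded_above[of "nbhd ?H x" "\<lambda>w. card (?g w)" 2] g by simp
  finally show ?thesis using x by simp
qed

text \<open>
  A triangle contains no centre of a block, because the neighbours of a centre are pairwise
  nonadjacent.
\<close>

lemma triangle_steiner_graph:
  assumes A: "named_steiner n A c"
  shows "triangle (steiner_graph n A c) T \<longleftrightarrow>
    T \<notin> A \<and> partial_steiner n (insert T A)" (is "?L \<longleftrightarrow> ?R")
proof
  have P: "partial_steiner n A" and c: "\<And>B. B \<in> A \<Longrightarrow> c B \<notin> {1..n}"
    using A by (auto simp: named_steiner_def)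
  let ?H = "steiner_graph n A c"
  {
    assume T: ?L
    then have card: "card T = 3" by (simp add: triangle_def)
    have adj: "v \<in> nbhd ?H u" if "u \<in> T" "v \<in> T" "u \<noteq> v" for u v
      using T that by (auto simp: triangle_def nbhd_def)
    have pt: "u \<in> {1..n}" if u: "u \<in> T" for u
    proof (rule ccontr)
      assume "u \<notin> {1..n}"
      then obtain B where B: "B \<in> A" "u = c B"
        using T u by (auto simp: triangle_def pverts_steiner_graph)
      have "card (T - {u}) = 2" using card u by simp
      then obtain v w where "v \<in> T - {u}" "w \<in> T - {u}" "v \<noteq> w"
        by (auto simp: card_2_iff)
      then have "v \<in> B" "w \<in> B" "w \<in> nbhd ?H v" "v \<noteq> w"
        using adj u B nbhd_centre[OF A B(1)] by blast+
      moreover from this have "v \<in> {1..n}" "w \<in> {1..n}"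
        using partial_steinerD(1)[OF P B(1)] by blast+
      ultimately show False
        using B(1) c unfolding nbhd_def steiner_graph_def by auto
    qed
    have free: False if "u \<in> T" "v \<in> T" "u \<noteq> v" "B \<in> A" "u \<in> B" "v \<in> B" for u v B
      using adj[OF that(1-3)] pt[OF that(1)] pt[OF that(2)] that(4-6) c
      unfolding nbhd_def steiner_graph_def by auto
    have "T \<notin> A"
    proof
      assume "T \<in> A"
      obtain u v where "u \<in> T" "v \<in> T" "u \<noteq> v" using card by (auto simp: card_3_iff)
      then show False using free \<open>T \<in> A\<close> by blast
    qed
    moreover have "partial_steiner n (insert T A)"
      using pt by (intro partial_steiner_insert[OF P _ card]) (auto dest: free)
    ultimately show ?R ..
  }
  {
    assume R: ?R
    then have T: "T \<subseteq> {1..n}" "card T = 3"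
      using partial_steinerD[of n "insert T A" T] by auto
    have "(u, v) \<in> parcs ?H" if "u \<in> T" "v \<in> T" "u \<noteq> v" for u v
    proof -
      have "\<not> (\<exists>B\<in>A. u \<in> B \<and> v \<in> B)"
        using R that partial_steiner_unique[of n "insert T A" T _ u v] by blast
      then show ?thesis using that T(1) by (auto simp: steiner_graph_def)
    qed
    then show ?L using T by (auto simp: triangle_def pverts_steiner_graph)
  }
qed

lemma delta_Y_steiner_graph:
  assumes A: "named_steiner n A c" and T: "T \<notin> A" "partial_steiner n (insert T A)"
  shows "delta_Y (steiner_graph n A c) T z = steiner_graph n (insert T A) (c(T := z))"
proof -
  have T': "T \<subseteq> {1..n}" using partial_steinerD(1)[OF T(2)] by blast
  have c: "\<And>B. B \<in> A \<Longrightarrow> c B \<notin> {1..n}" using A by (auto simp: named_steiner_def)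
  let ?c = "c(T := z)"
  have cT: "?c B = c B" if "B \<in> A" for B using T(1) that by auto
  have "(u, v) \<in> parcs (delta_Y (steiner_graph n A c) T z) \<longleftrightarrow>
      (u, v) \<in> parcs (steiner_graph n (insert T A) ?c)" for u v
  proof -
    have "(u, v) \<in> parcs (delta_Y (steiner_graph n A c) T z) \<longleftrightarrow>
        (u \<in> {1..n} \<and> v \<in> {1..n} \<and> u \<noteq> v \<and> \<not> (\<exists>B\<in>A. u \<in> B \<and> v \<in> B)
         \<or> (\<exists>B\<in>A. u = c B \<and> v \<in> B) \<or> (\<exists>B\<in>A. v = c B \<and> u \<in> B)) \<and> \<not> (u \<in> T \<and> v \<in> T)
        \<or> u = z \<and> v \<in> T \<or> u \<in> T \<and> v = z"
      by (simp add: delta_Y_def steiner_graph_def del: atLeastAtMost_iff)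
    also have "\<dots> \<longleftrightarrow>
        u \<in> {1..n} \<and> v \<in> {1..n} \<and> u \<noteq> v \<and> \<not> (\<exists>B\<in>A. u \<in> B \<and> v \<in> B) \<and> \<not> (u \<in> T \<and> v \<in> T)
         \<or> (\<exists>B\<in>A. u = c B \<and> v \<in> B) \<or> (\<exists>B\<in>A. v = c B \<and> u \<in> B)
         \<or> u = z \<and> v \<in> T \<or> u \<in> T \<and> v = z"
      using c T' by blast
    also have "\<dots> \<longleftrightarrow> (u, v) \<in> parcs (steiner_graph n (insert T A) ?c)"
      by (auto simp: steiner_graph_def cT simp del: atLeastAtMost_iff fun_upd_apply)
        (auto simp del: atLeastAtMost_iff)
    finally show ?thesis .
  qed
  moreover have "pverts (delta_Y (steiner_graph n A c) T z) = pverts (steiner_graph n (insert T A) ?c)"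
  proof -
    have "?c ` insert T A = insert z (c ` A)" 
      using image_cong[OF refl, of A ?c c, OF cT] by (metis fun_upd_same image_insert)
    then show ?thesis by (simp add: delta_Y_def pverts_steiner_graph del: fun_upd_apply)
  qed
  ultimately show ?thesis
    by (intro pair_pre_digraph.equality) auto
qed

lemma named_steiner_insert:
  assumes "named_steiner n A c" "T \<notin> A" "partial_steiner n (insert T A)"
    and "z \<notin> {1..n} \<union> c ` A"
  shows "named_steiner n (insert T A) (c(T := z))"
proof -
  have "inj_on (c(T := z)) (insert T A)"
    using assms by (auto simp: named_steiner_def inj_on_def)
  then show ?thesis using assms by (auto simp: named_steiner_def)
qed

text \<open>
  A Y-\<open>\<Delta>\<close> move at a centre undoes the \<open>\<Delta>\<close>-Y move: no other block covers a pair of points of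
  \<open>B\<close>, so the three edges restored are exactly those that \<open>B\<close> removed.
\<close>

lemma Y_delta_steiner_graph:
  assumes A: "named_steiner n A c" and B: "B \<in> A"
  shows "Y_delta (steiner_graph n A c) (c B) = steiner_graph n (A - {B}) c"
proof -
  have P: "partial_steiner n A" and c: "\<And>B. B \<in> A \<Longrightarrow> c B \<notin> {1..n}"
    and inj: "\<And>B'. B' \<in> A \<Longrightarrow> c B' = c B \<Longrightarrow> B' = B"
    using A B by (auto simp: named_steiner_def dest: inj_onD)
  have sub: "\<And>B'. B' \<in> A \<Longrightarrow> B' \<subseteq> {1..n}" using partial_steinerD(1)[OF P] .
  have notin: "c B \<notin> B'" if "B' \<in> A" for B' using c[OF B] sub[OF that] by blast
  have uniq: "B' = B" if "B' \<in> A" "u \<in> B" "v \<in> B" "u \<in> B'" "v \<in> B'" "u \<noteq> v" for B' u v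
    using partial_steiner_unique[OF P that(1) B] that by blast
  have "(u, v) \<in> parcs (Y_delta (steiner_graph n A c) (c B)) \<longleftrightarrow>
      (u, v) \<in> parcs (steiner_graph n (A - {B}) c)" for u v
  proof -
    have "(u, v) \<in> parcs (Y_delta (steiner_graph n A c) (c B)) \<longleftrightarrow>
      u \<noteq> c B \<and> v \<noteq> c B \<and>
        (u \<in> {1..n} \<and> v \<in> {1..n} \<and> u \<noteq> v \<and> \<not> (\<exists>B\<in>A. u \<in> B \<and> v \<in> B)
         \<or> (\<exists>B\<in>A. u = c B \<and> v \<in> B) \<or> (\<exists>B\<in>A. v = c B \<and> u \<in> B))
      \<or> u \<in> B \<and> v \<in> B \<and> u \<noteq> v"
      unfolding Y_delta_def nbhd_centre[OF A B] by (auto simp: steiner_graph_def)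
    also have "\<dots> \<longleftrightarrow>
        (u \<in> {1..n} \<and> v \<in> {1..n} \<and> u \<noteq> v \<and> \<not> (\<exists>B'\<in>A-{B}. u \<in> B' \<and> v \<in> B'))
         \<or> (\<exists>B'\<in>A-{B}. u = c B' \<and> v \<in> B') \<or> (\<exists>B'\<in>A-{B}. v = c B' \<and> u \<in> B')"
      (is "?l \<longleftrightarrow> ?r")
    proof
      assume ?l then show ?r using sub[OF B] uniq by blast
    next
      assume ?r then show ?l using c[OF B] inj notin by (metis DiffE singletonI DiffI singletonD)
    qed
    also have "\<dots> \<longleftrightarrow> (u, v) \<in> parcs (steiner_graph n (A - {B}) c)"
      by (simp add: steiner_graph_def)
    finally show ?thesis .
  qed
  moreover have "pverts (Y_delta (steiner_graph n A c) (c B)) = pverts (steiner_graph n (A - {B}) c)"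
    using c[OF B] inj by (auto simp: Y_delta_def pverts_steiner_graph)
  ultimately show ?thesis
    by (intro pair_pre_digraph.equality) auto
qed

lemma named_steiner_remove: "named_steiner n A c \<Longrightarrow> named_steiner n (A - {B}) c"
  unfolding named_steiner_def by (auto intro: partial_steiner_subset inj_on_subset)


section \<open>The family of the complete graph\<close>

text \<open>
  The statement on \<open>f\<close> says that all points survive; it determines the original vertices.
\<close>

lemma move_seq_complete_graph:
  assumes "n \<ge> 8" "move_seq (complete_graph n) Hs f"
  shows "(\<exists>A c. named_steiner n A c \<and> last Hs = steiner_graph n A c) \<and> f = Some |` {1..n}"
  using assms(2)
proof (induction rule: move_seq.induct)
  case start
  have "named_steiner n {} (\<lambda>_. 0)" by (simp add: named_steiner_def partial_steiner_def)
  moreover have "last [complete_graph n] = steiner_graph n {} (\<lambda>_. 0)"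
    by (simp add: steiner_graph_empty)
  moreover have "pverts (complete_graph n) = {1..n}" by (simp add: complete_graph_def)
  ultimately show ?case by metis
next
  case (delta_Y_step Hs f T z)
  then obtain A c where A: "named_steiner n A c" and L: "last Hs = steiner_graph n A c" by blast
  have T: "T \<notin> A" "partial_steiner n (insert T A)"
    using delta_Y_step.hyps(2) triangle_steiner_graph[OF A] L by auto
  have "z \<notin> pverts (last Hs)"
    using delta_Y_step.hyps(3) move_seq_last_in_set[OF delta_Y_step.hyps(1)] by blast
  then have "named_steiner n (insert T A) (c(T := z))"
    by (intro named_steiner_insert[OF A T]) (simp add: L pverts_steiner_graph)
  moreover have "delta_Y_emb (last Hs) \<circ>\<^sub>m f = Some |` {1..n}"
    using delta_Y_step.IH
    by (auto simp: L delta_Y_emb_def pverts_steiner_graph map_comp_def restrict_map_def fun_eq_iff)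
  ultimately show ?case
    using delta_Y_steiner_graph[OF A T] by (auto simp: L)
next
  case (Y_delta_step Hs f x)
  then obtain A c where A: "named_steiner n A c" and L: "last Hs = steiner_graph n A c" by blast
  \<comment> \<open>A point of degree 3 would give \<open>n - 1 \<le> 6\<close>.\<close>
  have "x \<notin> {1..n}"
    using degree_point[OF A, of x] Y_delta_step.hyps(3) assms(1) unfolding L by fastforce
  then obtain B where B: "B \<in> A" "x = c B"
    using Y_delta_step.hyps(2) by (auto simp: L pverts_steiner_graph)
  have "Y_delta_emb (last Hs) x \<circ>\<^sub>m f = Some |` {1..n}"
    using Y_delta_step.IH \<open>x \<notin> {1..n}\<close>
    by (auto simp: L Y_delta_emb_def pverts_steiner_graph map_comp_def restrict_map_def fun_eq_iff)
  then show ?case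
    using Y_delta_steiner_graph[OF A B(1)] named_steiner_remove[OF A] by (auto simp: L B(2))
qed

text \<open>
  The last equation says that the sequence uses no names besides those of the final graph. The
  induction needs it, because a new name must avoid all earlier graphs, not only the last.
\<close>

lemma steiner_graph_reachable:
  assumes "named_steiner n A c"
  shows "\<exists>Hs f. move_seq (complete_graph n) Hs f \<and> last Hs = steiner_graph n A c \<and>
    \<Union> (pverts ` set Hs) = {1..n} \<union> c ` A"
proof -
  have "finite A" using assms by (auto simp: named_steiner_def partial_steiner_finite)
  then show ?thesis using assms
  proof (induction A)
    case empty
    show ?case
      using move_seq.start[of "complete_graph n"]
      by (intro exI[of _ "[complete_graph n]"]) (auto simp: steiner_graph_empty complete_graph_def)
  next
    case (insert T A)
    have A: "named_steiner n A c"
      using named_steiner_remove[OF insert.prems, of T] insert.hyps by simp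
    have T: "partial_steiner n (insert T A)" using insert.prems by (simp add: named_steiner_def)
    obtain Hs f where Hs: "move_seq (complete_graph n) Hs f" "last Hs = steiner_graph n A c"
      "\<Union> (pverts ` set Hs) = {1..n} \<union> c ` A"
      using insert.IH[OF A] by blast
    have D: "delta_Y (last Hs) T (c T) = steiner_graph n (insert T A) c"
      using delta_Y_steiner_graph[OF A insert.hyps(2) T, of "c T"] by (simp add: Hs(2))
    have "triangle (last Hs) T"
      using triangle_steiner_graph[OF A] insert.hyps(2) T by (simp add: Hs(2))
    moreover have "c T \<notin> \<Union> (pverts ` set Hs)"
      using insert.prems insert.hyps(2) by (auto simp: Hs(3) named_steiner_def inj_on_def)
    ultimately have "move_seq (complete_graph n) (Hs @ [steiner_graph n (insert T A) c])
        (delta_Y_emb (last Hs) \<circ>\<^sub>m f)"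
      using move_seq.delta_Y_step[OF Hs(1)] D by metis
    moreover have "\<Union> (pverts ` set (Hs @ [steiner_graph n (insert T A) c])) =
        {1..n} \<union> c ` insert T A"
      using Hs(3) by (auto simp: pverts_steiner_graph)
    ultimately show ?case by (metis last_snoc)
  qed
qed

theorem labelled_family_complete_graph:
  assumes "n \<ge> 8"
  shows "labelled_family (complete_graph n) = {steiner_graph n A c | A c. named_steiner n A c}"
  using move_seq_complete_graph[OF assms] steiner_graph_reachable
  unfolding labelled_family_def by blast

lemma original_complete_graph:
  assumes "n \<ge> 8" "named_steiner n A c"
  shows "original (complete_graph n) (steiner_graph n A c) = {1..n}" (is "?O = _")
proof
  show "?O \<subseteq> {1..n}"
  proof
    fix y assume "y \<in> ?O"
    then obtain Hs f x where "move_seq (complete_graph n) Hs f" and fx: "f x = Some y"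
      by (auto simp: original_def)
    then have "f = Some |` {1..n}" using move_seq_complete_graph[OF assms(1)] by blast
    then show "y \<in> {1..n}" using fx by (simp add: restrict_map_def split: if_splits)
  qed
  obtain Hs f where Hs: "move_seq (complete_graph n) Hs f" "last Hs = steiner_graph n A c"
    using steiner_graph_reachable[OF assms(2)] by blast
  moreover have "f = Some |` {1..n}" using move_seq_complete_graph[OF assms(1) Hs(1)] by blast
  ultimately show "{1..n} \<subseteq> ?O"
    by (auto simp: original_def complete_graph_def pverts_steiner_graph intro!: exI[of _ Hs] exI[of _ f])
qed

lemma created_complete_graph:
  assumes "n \<ge> 8" "named_steiner n A c"
  shows "created (complete_graph n) (steiner_graph n A c) = c ` A"
  using assms(2)
  by (auto simp: created_def original_complete_graph[OF assms] pverts_steiner_graph named_steiner_def)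

lemma Phi_labelled_steiner_graph:
  assumes "n \<ge> 8" "named_steiner n A c"
  shows "Phi_labelled n (steiner_graph n A c) = A"
  using nbhd_centre[OF assms(2)]
  unfolding Phi_labelled_def created_complete_graph[OF assms] by auto


section \<open>Renaming\<close>

text \<open>
  With \<open>\<sigma> = id\<close> this describes the renamings of created vertices, and in general it describes
  the action of \<open>\<sigma>\<close> on labelled graphs.
\<close>

lemma rename_steiner_graph:
  assumes P: "partial_steiner n A" and \<sigma>: "\<sigma> permutes {1..n}"
    and g: "\<And>x. x \<in> {1..n} \<Longrightarrow> g x = \<sigma> x"
    and gc: "\<And>B. B \<in> A \<Longrightarrow> g (c B) = c' (\<sigma> ` B)"
  shows "rename g (steiner_graph n A c) = steiner_graph n (steiner_act \<sigma> A) c'"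
proof (intro pair_pre_digraph.equality)
  have inj: "inj \<sigma>" and im: "\<sigma> ` {1..n} = {1..n}"
    using permutes_inj[OF \<sigma>] permutes_image[OF \<sigma>] .
  have g': "g u = \<sigma> u" if "B \<in> A" "u \<in> B" for u B
    using g partial_steinerD(1)[OF P that(1)] that(2) by blast
  have gim: "g ` {1..n} = {1..n}" using g im by (metis image_cong)
  have gcim: "g ` c ` A = c' ` steiner_act \<sigma> A"
    unfolding steiner_act_def image_image using gc by (rule image_cong[OF refl])
  show "pverts (rename g (steiner_graph n A c)) = pverts (steiner_graph n (steiner_act \<sigma> A) c')"
    by (simp only: rename_def pair_pre_digraph.simps pverts_steiner_graph image_Un gim gcim)
  let ?X = "\<lambda>A. {(u, v). u \<in> {1..n} \<and> v \<in> {1..n} \<and> u \<noteq> v \<and> \<not> (\<exists>B\<in>A. u \<in> B \<and> v \<in> B)}"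
  let ?Y = "\<lambda>A c. {(u, v). \<exists>B\<in>A. u = c B \<and> v \<in> B}"
  let ?Z = "\<lambda>A c. {(u, v). \<exists>B\<in>A. v = c B \<and> u \<in> B}"
  have "map_prod g g ` ?X A = ?X (steiner_act \<sigma> A)"
  proof -
    have iff: "(\<sigma> u, \<sigma> v) \<in> ?X (steiner_act \<sigma> A) \<longleftrightarrow> (u, v) \<in> ?X A" for u v
      using inj permutes_in_image[OF \<sigma>]
      by (auto simp: steiner_act_def inj_image_mem_iff dest: injD)
    have "map_prod g g ` ?X A = map_prod \<sigma> \<sigma> ` ?X A"
      using g by (intro image_cong) auto
    also have "\<dots> = ?X (steiner_act \<sigma> A)"
    proof
      show "map_prod \<sigma> \<sigma> ` ?X A \<subseteq> ?X (steiner_act \<sigma> A)" using iff by auto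
      show "?X (steiner_act \<sigma> A) \<subseteq> map_prod \<sigma> \<sigma> ` ?X A"
      proof
        fix e assume e: "e \<in> ?X (steiner_act \<sigma> A)"
        obtain u v where uv: "e = (\<sigma> u, \<sigma> v)"
          using permutes_surj[OF \<sigma>] by (metis surj_def surj_pair)
        have "(u, v) \<in> ?X A" using e unfolding uv iff .
        then show "e \<in> map_prod \<sigma> \<sigma> ` ?X A"
          unfolding uv map_prod_simp[symmetric] by (rule imageI)
      qed
    qed
    finally show ?thesis .
  qed
  moreover have "map_prod g g ` ?Y A c = ?Y (steiner_act \<sigma> A) c'"
  proof -
    have "map_prod g g ` ?Y A c = (\<Union>B\<in>A. (\<lambda>u. (g (c B), g u)) ` B)" by force
    also have "\<dots> = (\<Union>B\<in>A. (\<lambda>u. (c' (\<sigma> ` B), \<sigma> u)) ` B)"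
      using gc g' by (intro SUP_cong image_cong) auto
    also have "\<dots> = ?Y (steiner_act \<sigma> A) c'" by (auto simp: steiner_act_def)
    finally show ?thesis .
  qed
  moreover have "map_prod g g ` ?Z A c = ?Z (steiner_act \<sigma> A) c'"
  proof -
    have "map_prod g g ` ?Z A c = (\<Union>B\<in>A. (\<lambda>u. (g u, g (c B))) ` B)" by force
    also have "\<dots> = (\<Union>B\<in>A. (\<lambda>u. (\<sigma> u, c' (\<sigma> ` B))) ` B)"
      using gc g' by (intro SUP_cong image_cong) auto
    also have "\<dots> = ?Z (steiner_act \<sigma> A) c'" by (auto simp: steiner_act_def)
    finally show ?thesis .
  qed
  ultimately show "parcs (rename g (steiner_graph n A c)) = parcs (steiner_graph n (steiner_act \<sigma> A) c')"
    by (simp only: rename_def steiner_graph_def pair_pre_digraph.simps image_Un)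
qed simp

lemma steiner_act_id: "steiner_act id A = A"
  by (simp add: steiner_act_def)

lemma created_renaming_iff_Phi_labelled:
  assumes n: "n \<ge> 8"
    and "H \<in> labelled_family (complete_graph n)" "K \<in> labelled_family (complete_graph n)"
  shows "(H, K) \<in> created_renaming (complete_graph n) \<longleftrightarrow> Phi_labelled n H = Phi_labelled n K"
proof -
  obtain A c where A: "named_steiner n A c" and H: "H = steiner_graph n A c"
    using assms by (auto simp: labelled_family_complete_graph)
  obtain A' c' where A': "named_steiner n A' c'" and K: "K = steiner_graph n A' c'"
    using assms by (auto simp: labelled_family_complete_graph)
  have P: "partial_steiner n A" using A by (simp add: named_steiner_def)
  have orig: "original (complete_graph n) H = {1..n}"
    and pts: "pverts H = {1..n} \<union> c ` A"
    and created: "created (complete_graph n) H = c ` A" "created (complete_graph n) K = c' ` A'"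
    by (simp_all only: H K original_complete_graph[OF n A] pverts_steiner_graph
        created_complete_graph[OF n A] created_complete_graph[OF n A'])
  have "(H, K) \<in> created_renaming (complete_graph n) \<longleftrightarrow> A = A'"
  proof
    assume "(H, K) \<in> created_renaming (complete_graph n)"
    then obtain g where g: "inj_on g ({1..n} \<union> c ` A)" "\<And>x. x \<in> {1..n} \<Longrightarrow> g x = x"
      "g ` c ` A = c' ` A'" "K = rename g H"
      unfolding created_renaming_def by (auto simp: orig pts created)
    define d where "d B = g (c B)" for B
    have "K = steiner_graph n A d"
      using rename_steiner_graph[OF P permutes_id, of g c d] g(2)
      by (simp add: g(4) H d_def steiner_act_id)
    moreover have "named_steiner n A d"
    proof -
      have "inj_on d A"
        using comp_inj_on[of c A g] A inj_on_subset[OF g(1)]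
        by (simp add: named_steiner_def d_def[abs_def] comp_def)
      moreover have "d B \<notin> {1..n}" if "B \<in> A" for B
      proof -
        have "d B \<in> c' ` A'" using that g(3) by (auto simp: d_def)
        then show ?thesis using A' by (auto simp: named_steiner_def)
      qed
      ultimately show ?thesis using P by (simp add: named_steiner_def)
    qed
    ultimately show "A = A'"
      using Phi_labelled_steiner_graph[OF n] A' K by metis
  next
    assume eq: "A = A'"
    define g where "g x = (if x \<in> {1..n} then x else c' (inv_into A c x))" for x
    have gp: "g x = x" if "x \<in> {1..n}" for x using that by (simp add: g_def)
    have gc: "g (c B) = c' B" if "B \<in> A" for B
      using that A by (auto simp: g_def named_steiner_def)
    have "K = rename g H"
      using rename_steiner_graph[OF P permutes_id, of g c c'] gp gc
      by (simp add: H K eq steiner_act_id)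
    moreover have "g ` c ` A = c' ` A" unfolding image_image using gc by (rule image_cong[OF refl])
    moreover have "inj_on g ({1..n} \<union> c ` A)"
    proof (rule inj_onI)
      fix x y assume "x \<in> {1..n} \<union> c ` A" "y \<in> {1..n} \<union> c ` A" "g x = g y"
      then show "x = y"
        using gp gc A' by (auto simp: eq named_steiner_def dest: inj_onD)
    qed
    ultimately show "(H, K) \<in> created_renaming (complete_graph n)"
      using assms(2,3) gp orig pts created eq unfolding created_renaming_def
      by (intro CollectI case_prodI conjI exI[of _ g]) simp_all
  qed
  then show ?thesis
    by (simp add: H K Phi_labelled_steiner_graph[OF n A] Phi_labelled_steiner_graph[OF n A'])
qed

text \<open>
  The class of the family that belongs to \<open>A\<close>: all graphs of \<open>A\<close>, under every admissible naming
  of its blocks. These classes are the fibres of \<^const>\<open>Phi_labelled\<close> on the labelled family.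
\<close>

definition steiner_class :: "nat \<Rightarrow> nat set set \<Rightarrow> lgraph set" where
  "steiner_class n A = {steiner_graph n A c | c. named_steiner n A c}"

lemma ex_named_steiner:
  assumes "partial_steiner n A"
  shows "\<exists>c. named_steiner n A c"
proof -
  obtain c :: "nat set \<Rightarrow> nat" where "inj_on c A"
    using finite_imp_inj_to_nat_seg[OF partial_steiner_finite[OF assms]] by blast
  \<comment> \<open>The shift moves the names beyond the points \<open>{1..n}\<close>.\<close>
  then have "named_steiner n A (\<lambda>B. Suc n + c B)"
    using assms by (auto simp: named_steiner_def inj_on_def)
  then show ?thesis by blast
qed

lemma Phi_steiner_class:
  assumes "n \<ge> 8" "partial_steiner n A"
  shows "Phi n (steiner_class n A) = A"
proof -
  have "Phi_labelled n ` steiner_class n A = {A}"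
    using Phi_labelled_steiner_graph[OF assms(1)] ex_named_steiner[OF assms(2)]
    by (auto simp: steiner_class_def image_iff)
  then show ?thesis by (simp add: Phi_def)
qed

lemma family_complete_graph:
  assumes n: "n \<ge> 8"
  shows "family (complete_graph n) = steiner_class n ` {A. partial_steiner n A}"
proof -
  have cls: "created_renaming (complete_graph n) `` {steiner_graph n A c} = steiner_class n A"
    if A: "named_steiner n A c" for A c
  proof -
    let ?H = "steiner_graph n A c"
    have H: "?H \<in> labelled_family (complete_graph n)"
      using A by (auto simp: labelled_family_complete_graph[OF n])
    have "(?H, K) \<in> created_renaming (complete_graph n) \<longleftrightarrow>
        K \<in> labelled_family (complete_graph n) \<and> Phi_labelled n K = A" for K
      using created_renaming_iff_Phi_labelled[OF n H, of K] Phi_labelled_steiner_graph[OF n A]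
      by (auto simp: created_renaming_def)
    moreover have "K \<in> labelled_family (complete_graph n) \<and> Phi_labelled n K = A \<longleftrightarrow>
        K \<in> steiner_class n A" for K
      using Phi_labelled_steiner_graph[OF n]
      by (auto simp: steiner_class_def labelled_family_complete_graph[OF n])
    ultimately show ?thesis by auto
  qed
  show ?thesis
  proof (intro equalityI subsetI)
    fix C assume "C \<in> family (complete_graph n)"
    then obtain A c where A: "named_steiner n A c" "C = steiner_class n A"
      unfolding family_def labelled_family_complete_graph[OF n]
      by (auto elim!: quotientE simp: cls)
    then show "C \<in> steiner_class n ` {A. partial_steiner n A}" by (simp add: named_steiner_def)
  next
    fix C assume "C \<in> steiner_class n ` {A. partial_steiner n A}"
    then obtain A c where A: "named_steiner n A c" "C = steiner_class n A"
      using ex_named_steiner by blast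
    then have "steiner_graph n A c \<in> labelled_family (complete_graph n)"
      by (auto simp: labelled_family_complete_graph[OF n])
    then show "C \<in> family (complete_graph n)"
      using quotientI cls[OF A(1)] A(2) unfolding family_def by metis
  qed
qed


section \<open>Edges, grading and equivariance\<close>

lemma parcs_family_digraph:
  assumes n: "n \<ge> 8" and A: "partial_steiner n A" and A': "partial_steiner n A'"
  shows "(steiner_class n A, steiner_class n A') \<in> parcs (family_digraph (complete_graph n)) \<longleftrightarrow>
    (A, A') \<in> parcs (steiner_digraph n)" (is "?L \<longleftrightarrow> ?R")
proof -
  have fam: "steiner_class n A \<in> family (complete_graph n)"
    "steiner_class n A' \<in> family (complete_graph n)"
    using A A' by (auto simp: family_complete_graph[OF n])
  have Phi: "Phi_labelled n H = A'" if "H \<in> steiner_class n A'" for H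
    using that Phi_labelled_steiner_graph[OF n] by (auto simp: steiner_class_def)
  have step: "delta_Y (steiner_graph n A c) T z \<in> steiner_class n (insert T A) \<and>
      Phi_labelled n (delta_Y (steiner_graph n A c) T z) = insert T A"
    if "named_steiner n A c" "T \<notin> A" "partial_steiner n (insert T A)" "z \<notin> {1..n} \<union> c ` A" for c T z
    using named_steiner_insert[OF that] delta_Y_steiner_graph[OF that(1-3)]
      Phi_labelled_steiner_graph[OF n] by (auto simp: steiner_class_def)
  show ?thesis
  proof
    assume ?L
    then obtain H T z where H: "H \<in> steiner_class n A" "triangle H T" "z \<notin> pverts H"
      "delta_Y H T z \<in> steiner_class n A'"
      by (auto simp: family_digraph_def)
    then obtain c where c: "named_steiner n A c" "H = steiner_graph n A c"
      by (auto simp: steiner_class_def)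
    have T: "T \<notin> A" "partial_steiner n (insert T A)"
      using H(2) triangle_steiner_graph[OF c(1)] by (auto simp: c(2))
    have "A' = insert T A"
      using step[OF c(1) T] H(3) Phi[OF H(4)] by (simp add: c(2) pverts_steiner_graph)
    then have "A \<subset> A'" "A' - A = {T}" using T(1) by auto
    then show ?R using A A' by (simp add: steiner_digraph_def)
  next
    assume ?R
    then have "A \<subseteq> A'" "card (A' - A) = 1" by (auto simp: steiner_digraph_def)
    then obtain T where T: "A' = insert T A" "T \<notin> A" by (auto simp: card_1_singleton_iff)
    obtain c where c: "named_steiner n A c" using ex_named_steiner[OF A] by blast
    obtain z where z: "z \<notin> {1..n} \<union> c ` A"
      using ex_new_if_finite[of "{1..n} \<union> c ` A"] partial_steiner_finite[OF A] by auto
    have "triangle (steiner_graph n A c) T"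
      using triangle_steiner_graph[OF c] T A' by simp
    moreover have "delta_Y (steiner_graph n A c) T z \<in> steiner_class n A'"
      using step[OF c T(2) _ z] A' T(1) by simp
    moreover have "steiner_graph n A c \<in> steiner_class n A" using c by (auto simp: steiner_class_def)
    moreover have "z \<notin> pverts (complete_graph n) \<union> pverts (steiner_graph n A c)"
      using z by (simp add: complete_graph_def pverts_steiner_graph)
    ultimately show ?L using fam unfolding family_digraph_def by auto
  qed
qed

lemma card_pverts_steiner_graph:
  assumes "named_steiner n A c"
  shows "card (pverts (steiner_graph n A c)) = n + card A"
proof -
  have "card ({1..n} \<union> c ` A) = card {1..n} + card (c ` A)"
    using assms partial_steiner_finite
    by (intro card_Un_disjoint) (auto simp: named_steiner_def)
  then show ?thesis
    using assms by (simp add: pverts_steiner_graph named_steiner_def card_image)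
qed

lemma relabel_steiner_graph:
  assumes n: "n \<ge> 8" and A: "named_steiner n A c" and \<sigma>: "\<sigma> permutes {1..n}"
    and c': "\<And>B. B \<in> A \<Longrightarrow> c' (\<sigma> ` B) = c B"
  shows "relabel (complete_graph n) \<sigma> (steiner_graph n A c) = steiner_graph n (steiner_act \<sigma> A) c'"
  unfolding relabel_def original_complete_graph[OF n A]
proof (rule rename_steiner_graph[OF _ \<sigma>])
  show "partial_steiner n A" using A by (simp add: named_steiner_def)
  show "(if c B \<in> {1..n} then \<sigma> (c B) else c B) = c' (\<sigma> ` B)" if "B \<in> A" for B
    using A that c'[OF that] by (auto simp: named_steiner_def)
qed simp

lemma family_act_steiner_class:
  assumes n: "n \<ge> 8" and A: "partial_steiner n A" and \<sigma>: "\<sigma> permutes {1..n}"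
  shows "family_act (complete_graph n) \<sigma> (steiner_class n A) = steiner_class n (steiner_act \<sigma> A)"
proof -
  have inj: "inj \<sigma>" using permutes_inj[OF \<sigma>] .
  have inv: "inv \<sigma> ` \<sigma> ` B = B" for B using inj by (simp add: image_image)
  have named: "named_steiner n (steiner_act \<sigma> A) c' \<longleftrightarrow> named_steiner n A (\<lambda>B. c' (\<sigma> ` B))" for c'
  proof -
    have "inj_on ((`) \<sigma>) A" using inv by (metis inj_onI)
    then have "inj_on c' (steiner_act \<sigma> A) \<longleftrightarrow> inj_on (c' \<circ> (`) \<sigma>) A"
      unfolding steiner_act_def by (rule comp_inj_on_iff)
    then show ?thesis
      using A partial_steiner_image[OF \<sigma> A]
      by (simp add: named_steiner_def comp_def) (simp add: steiner_act_def)
  qed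
  show ?thesis
  proof (intro equalityI subsetI)
    fix K assume "K \<in> family_act (complete_graph n) \<sigma> (steiner_class n A)"
    then obtain c where c: "named_steiner n A c"
      and K: "K = relabel (complete_graph n) \<sigma> (steiner_graph n A c)"
      by (auto simp: family_act_def steiner_class_def)
    have "K = steiner_graph n (steiner_act \<sigma> A) (\<lambda>B. c (inv \<sigma> ` B))"
      unfolding K by (rule relabel_steiner_graph[OF n c \<sigma>]) (simp only: inv)
    moreover have "named_steiner n (steiner_act \<sigma> A) (\<lambda>B. c (inv \<sigma> ` B))"
      unfolding named using c by (simp only: inv)
    ultimately show "K \<in> steiner_class n (steiner_act \<sigma> A)" by (auto simp: steiner_class_def)
  next
    fix K assume "K \<in> steiner_class n (steiner_act \<sigma> A)"
    then obtain c where c: "named_steiner n (steiner_act \<sigma> A) c"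
      and K: "K = steiner_graph n (steiner_act \<sigma> A) c"
      by (auto simp: steiner_class_def)
    have c': "named_steiner n A (\<lambda>B. c (\<sigma> ` B))" using c named by simp
    have "K = relabel (complete_graph n) \<sigma> (steiner_graph n A (\<lambda>B. c (\<sigma> ` B)))"
      unfolding K by (rule relabel_steiner_graph[OF n c' \<sigma>, symmetric]) simp
    then show "K \<in> family_act (complete_graph n) \<sigma> (steiner_class n A)"
      using c' by (auto simp: family_act_def steiner_class_def)
  qed
qed

theorem theorem1:
  fixes n :: nat
  assumes "n \<ge> 8"
  shows "Phi_labelled n respects created_renaming (complete_graph n) \<and>
    (\<forall>C \<in> family (complete_graph n). \<forall>H\<in>C. Phi n C = Phi_labelled n H) \<and>
    (\<forall>C \<in> family (complete_graph n). partial_steiner n (Phi n C)) \<and>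
    bij_betw (Phi n) (pverts (family_digraph (complete_graph n))) (pverts (steiner_digraph n)) \<and>
    (\<forall>C \<in> family (complete_graph n). \<forall>D \<in> family (complete_graph n).
       (C, D) \<in> parcs (family_digraph (complete_graph n)) \<longleftrightarrow>
       (Phi n C, Phi n D) \<in> parcs (steiner_digraph n)) \<and>
    (\<forall>C \<in> family (complete_graph n). \<forall>H\<in>C.
       int (card (pverts H)) - int n = int (card (Phi n C))) \<and>
    (\<forall>\<sigma>. \<sigma> permutes {1..n} \<longrightarrow>
       (\<forall>C \<in> family (complete_graph n).
          family_act (complete_graph n) \<sigma> C \<in> family (complete_graph n) \<and>
          Phi n (family_act (complete_graph n) \<sigma> C) = steiner_act \<sigma> (Phi n C)))"
proof (intro conjI ballI allI impI)
  let ?F = "family (complete_graph n)"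
  note n = assms
  have famE: "\<exists>A. partial_steiner n A \<and> C = steiner_class n A" if "C \<in> ?F" for C
    using that by (auto simp: family_complete_graph[OF n])
  have memE: "\<exists>A c. named_steiner n A c \<and> H = steiner_graph n A c \<and> Phi n C = A"
    if "C \<in> ?F" "H \<in> C" for C H
  proof -
    obtain A where A: "partial_steiner n A" "C = steiner_class n A" using famE \<open>C \<in> ?F\<close> by blast
    then show ?thesis
      using \<open>H \<in> C\<close> Phi_steiner_class[OF n A(1)] by (auto simp: steiner_class_def)
  qed
  show "Phi_labelled n respects created_renaming (complete_graph n)"
  proof (rule congruentI)
    fix H K assume HK: "(H, K) \<in> created_renaming (complete_graph n)"
    then have "H \<in> labelled_family (complete_graph n)" "K \<in> labelled_family (complete_graph n)"
      by (auto simp: created_renaming_def)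
    then show "Phi_labelled n H = Phi_labelled n K"
      using HK created_renaming_iff_Phi_labelled[OF n] by blast
  qed
  show "bij_betw (Phi n) (pverts (family_digraph (complete_graph n))) (pverts (steiner_digraph n))"
    by (rule bij_betw_byWitness[where f' = "steiner_class n"])
      (auto simp: family_digraph_def steiner_digraph_def family_complete_graph[OF n]
        Phi_steiner_class[OF n])
  fix C assume C: "C \<in> ?F"
  then obtain A where A: "partial_steiner n A" and CA: "C = steiner_class n A" using famE by blast
  have PA: "Phi n C = A" using Phi_steiner_class[OF n A] CA by simp
  show "partial_steiner n (Phi n C)" using A PA by simp
  {
    fix H assume "H \<in> C"
    then obtain c where c: "named_steiner n A c" "H = steiner_graph n A c"
      using memE[OF C] PA by blast
    then show "Phi n C = Phi_labelled n H" using Phi_labelled_steiner_graph[OF n c(1)] PA by simp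
    show "int (card (pverts H)) - int n = int (card (Phi n C))"
      using card_pverts_steiner_graph[OF c(1)] c(2) PA by simp
  }
  {
    fix D assume "D \<in> ?F"
    then obtain A' where A': "partial_steiner n A'" "D = steiner_class n A'" using famE by blast
    show "((C, D) \<in> parcs (family_digraph (complete_graph n))) =
        ((Phi n C, Phi n D) \<in> parcs (steiner_digraph n))"
      using parcs_family_digraph[OF n A A'(1)] Phi_steiner_class[OF n A'(1)] PA A'(2) CA by simp
  }
  {
    fix \<sigma> assume \<sigma>: "\<sigma> permutes {1..n}"
    note act = family_act_steiner_class[OF n A \<sigma>] and P = partial_steiner_image[OF \<sigma> A]
    show "family_act (complete_graph n) \<sigma> C \<in> ?F"
      using act P by (simp add: CA family_complete_graph[OF n])
    show "Phi n (family_act (complete_graph n) \<sigma> C) = steiner_act \<sigma> (Phi n C)"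
      using act PA Phi_steiner_class[OF n P] by (simp add: CA)
  }
qed

end
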